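(* Let $b_n=\sqrt{\mathrm{LL}(n)/n}$, where $\mathrm{LL}(u)=1\vee\log\log(u\vee e^{e})$. (i) If $\Delta_n=O_{\mathrm{as}^{*}}(b_n)$, then $$\lvert\hat\psi_n-\psi^{*}\rvert=O_{\mathrm{as}^{*}}(b_n).$$ Moreover, for every nonnegative deterministic sequence $\delta_n=O(b_n)$ and every sequence of maps $\hat x_n:\Omega\to X$ satisfying the empirical minimizer membership assumption with respect to $(\delta_n)$, $$f(\hat x_n)-\psi^{*}=O_{\mathrm{as}^{*}}(b_n),$$ and, if $f$ also satisfies a sharp-growth inequality of order $\kappa$, $$\operatorname{dist}(\hat x_n,S^{0})=O_{\mathrm{as}^{*}}(b_n^{1/\kappa}).$$ (ii) If, for some deterministic sequence $\rho_n\downarrow0$, $\mathbb E^{*}\Delta_n=O(\rho_n)$, then $$\mathbb E^{*}\lvert\hat\psi_n-\psi^{*}\rvert=O(\rho_n).$$ If, in addition, $(\delta_n)$ is a nonnegative deterministic sequence with $\delta_n=O(\rho_n)$, and $\hat x_n:\Omega\to X$ is a sequence of maps satisfying the empirical minimizer membership assumption with respect to $(\delta_n)$ with events $A_{\min,N}$ that can be chosen so that $\mathbb P(A_{\min,n}^{c})=O(\rho_n)$, then $$\mathbb E^{*}\bigl[f(\hat x_n)-\psi^{*}\bigr]=O(\rho_n),$$ and, if $f$ also satisfies a sharp-growth inequality of order $\kappa$, $$\mathbb E^{*}\operatorname{dist}(\hat x_n,S^{0})^{\kappa}=O(\rho_n).$$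
   Context: Setting. $(\Omega,\mathcal F,\mathbb P)$ is a probability space, $(\Xi,\mathcal G)$ a measurable space, $\xi,\xi_1,\xi_2,\dots$ are i.i.d. $\Xi$-valued random elements on $\Omega$ with law $P$, $X$ is a nonempty set, and $h:X\times\Xi\to\mathbb R$ is such that each section $h_x=h(x,\cdot)$ is measurable and $P$-integrable. Put $f(x)=\mathbb E[h(x,\xi)]$, $\hat f_n(x)=\frac1n\sum_{i=1}^n h(x,\xi_i)$, $\psi^{*}=\inf_{X}f$, $\hat\psi_n=\inf_{X}\hat f_n$, $S^{\varepsilon}=\{x\in X: f(x)\le\psi^{*}+\varepsilon\}$, $\hat S_n^{\delta}=\{x\in X:\hat f_n(x)\le\hat\psi_n+\delta\}$ ($\varepsilon,\delta\ge0$; $\hat S_n^\delta=\hat S_n^\delta(\omega)$ is random), and $\Delta_n=\sup_{x\in X}|\hat f_n(x)-f(x)|$. Standing assumption (bounded-objective regime): $f$ is bounded on $X$, and, for all sufficiently large $n$, $\hat f_n-f$ is bounded on $X$ almost surely. Empirical minimizer membership assumption (for maps $\hat x_n:\Omega\to X$ and nonnegative deterministic $(\delta_n)$): there are events $A_{\min,N}\in\mathcal F$, $N\in\mathbb N$, with $A_{\min,N}\subseteq A_{\min,N+1}$ and $\mathbb P(\bigcup_N A_{\min,N})=1$, such that $\hat x_n(\omega)\in\hat S_n^{\delta_n}(\omega)$ for every $N$, every $\omega\in A_{\min,N}$ and every $n\ge N$. Sharp growth of order $\kappa\ge1$: $X\subseteq\mathbb R^d$, $S^{0}\ne\varnothing$,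 and there is $\alpha>0$ with $f(x)-\psi^{*}\ge\alpha\operatorname{dist}(x,S^{0})^{\kappa}$ for all $x\in X$ (Euclidean distance). Outer notions. For a possibly nonmeasurable $U:\Omega\to[-\infty,\infty]$, $\mathbb E^{*}U=\inf\{\mathbb E[V]: V\ge U,\ V\text{ measurable},\ \mathbb E[V]\text{ exists}\}$. $U^{*}$ denotes a version of the minimal measurable majorant of $U$ (a measurable $U^*\ge U$ with $U^*\le V$ a.s. for every measurable $V\ge U$ a.s.). $U_n=O_{\mathrm{as}^{*}}(r_n)$ means that, for some versions of the minimal measurable majorants, $\limsup_n|U_n|^{*}/r_n<\infty$ almost surely. *)

theory Defs
  imports "HOL-Probability.Probability"
begin

section \<open>Outer expectation and measurable majorants\<close>

text \<open>
  The expectation of an extended-real function is the difference of the integrals of its positive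
  and negative parts (\<^const>\<open>e2ennreal\<close> sends negative arguments to \<open>0\<close>). It exists if these
  are not both infinite; in that case the difference is unambiguous.
\<close>

definition ext_expectation :: "'w measure \<Rightarrow> ('w \<Rightarrow> ereal) \<Rightarrow> ereal" where
  "ext_expectation M V =
     enn2ereal (\<integral>\<^sup>+ \<omega>. e2ennreal (V \<omega>) \<partial>M) - enn2ereal (\<integral>\<^sup>+ \<omega>. e2ennreal (- V \<omega>) \<partial>M)"

definition ext_expectation_exists :: "'w measure \<Rightarrow> ('w \<Rightarrow> ereal) \<Rightarrow> bool" where
  "ext_expectation_exists M V \<longleftrightarrow>
     (\<integral>\<^sup>+ \<omega>. e2ennreal (V \<omega>) \<partial>M) < \<infinity> \<or> (\<integral>\<^sup>+ \<omega>. e2ennreal (- V \<omega>) \<partial>M) < \<infinity>"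

definition outer_expectation :: "'w measure \<Rightarrow> ('w \<Rightarrow> ereal) \<Rightarrow> ereal" where
  "outer_expectation M U =
     Inf {ext_expectation M V | V.
            V \<in> borel_measurable M \<and> (\<forall>\<omega>\<in>space M. U \<omega> \<le> V \<omega>) \<and> ext_expectation_exists M V}"

definition min_meas_majorant :: "'w measure \<Rightarrow> ('w \<Rightarrow> ereal) \<Rightarrow> ('w \<Rightarrow> ereal) \<Rightarrow> bool" where
  "min_meas_majorant M U V \<longleftrightarrow>
     V \<in> borel_measurable M \<and> (\<forall>\<omega>\<in>space M. U \<omega> \<le> V \<omega>) \<and>
     (\<forall>W\<in>borel_measurable M. (AE \<omega> in M. U \<omega> \<le> W \<omega>) \<longrightarrow> (AE \<omega> in M. V \<omega> \<le> W \<omega>))"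

definition O_as_star :: "'w measure \<Rightarrow> (nat \<Rightarrow> 'w \<Rightarrow> ereal) \<Rightarrow> (nat \<Rightarrow> real) \<Rightarrow> bool" where
  "O_as_star M U r \<longleftrightarrow>
     (\<exists>V. (\<forall>n. min_meas_majorant M (\<lambda>\<omega>. \<bar>U n \<omega>\<bar>) (V n)) \<and>
          (AE \<omega> in M. limsup (\<lambda>n. V n \<omega> / ereal (r n)) < \<infinity>))"

text \<open>
  Landau's symbol for a sequence of extended reals, which may be infinite for finitely many \<open>n\<close>.
\<close>

definition ereal_bigo :: "(nat \<Rightarrow> ereal) \<Rightarrow> (nat \<Rightarrow> real) \<Rightarrow> bool" where
  "ereal_bigo u r \<longleftrightarrow> (\<exists>C::real. eventually (\<lambda>n. \<bar>u n\<bar> \<le> ereal (C * \<bar>r n\<bar>)) sequentially)"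

section \<open>Sample average approximation\<close>

text \<open>
  Index \<open>0\<close> of \<open>\<xi>\<close> is the generic element with the common law; \<open>\<xi> 1, \<xi> 2, \<dots>\<close> is the sample.
\<close>

definition true_obj :: "'w measure \<Rightarrow> (nat \<Rightarrow> 'w \<Rightarrow> 's) \<Rightarrow> ('x \<Rightarrow> 's \<Rightarrow> real) \<Rightarrow> 'x \<Rightarrow> real" where
  "true_obj M \<xi> h x = (\<integral>\<omega>. h x (\<xi> 0 \<omega>) \<partial>M)"

definition emp_obj ::
  "(nat \<Rightarrow> 'w \<Rightarrow> 's) \<Rightarrow> ('x \<Rightarrow> 's \<Rightarrow> real) \<Rightarrow> nat \<Rightarrow> 'w \<Rightarrow> 'x \<Rightarrow> real" where
  "emp_obj \<xi> h n \<omega> x = (1 / real n) * (\<Sum>i = 1..n. h x (\<xi> i \<omega>))"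

text \<open>
  Infima and suprema are taken in the extended reals, since \<open>emp_obj \<xi> h n \<omega>\<close> may be unbounded
  for small \<open>n\<close> or exceptional \<open>\<omega>\<close>.
\<close>

definition opt_val :: "'x set \<Rightarrow> ('x \<Rightarrow> real) \<Rightarrow> ereal" where
  "opt_val X g = (INF x\<in>X. ereal (g x))"

definition near_opt :: "'x set \<Rightarrow> ('x \<Rightarrow> real) \<Rightarrow> real \<Rightarrow> 'x set" where
  "near_opt X g \<epsilon> = {x\<in>X. ereal (g x) \<le> opt_val X g + ereal \<epsilon>}"

definition sup_dev :: "'x set \<Rightarrow> ('x \<Rightarrow> real) \<Rightarrow> ('x \<Rightarrow> real) \<Rightarrow> ereal" where
  "sup_dev X g f = (SUP x\<in>X. ereal \<bar>g x - f x\<bar>)"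

definition emp_min_membership ::
  "'w measure \<Rightarrow> 'x set \<Rightarrow> (nat \<Rightarrow> 'w \<Rightarrow> 'x \<Rightarrow> real) \<Rightarrow> (nat \<Rightarrow> real) \<Rightarrow> (nat \<Rightarrow> 'w \<Rightarrow> 'x) \<Rightarrow>
     (nat \<Rightarrow> 'w set) \<Rightarrow> bool" where
  "emp_min_membership M X fhat \<delta> xhat A \<longleftrightarrow>
     (\<forall>N. A N \<in> sets M) \<and> (\<forall>N. A N \<subseteq> A (Suc N)) \<and> measure M (\<Union>N. A N) = 1 \<and>
     (\<forall>N. \<forall>\<omega>\<in>A N. \<forall>n\<ge>N. xhat n \<omega> \<in> near_opt X (fhat n \<omega>) (\<delta> n))"

text \<open>
  The feasible set is abstract, so \<open>X \<subseteq> \<real>\<^sup>d\<close> is expressed by a map \<open>\<iota>\<close> into a Euclidean space that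
  is injective on \<open>X\<close>; the literal case is \<open>\<iota> = id\<close>. Distances are Euclidean distances of
  \<open>\<iota>\<close>-images.
\<close>

definition eucl_dist :: "('x \<Rightarrow> 'e::euclidean_space) \<Rightarrow> 'x \<Rightarrow> 'x set \<Rightarrow> real" where
  "eucl_dist \<iota> x S = infdist (\<iota> x) (\<iota> ` S)"

definition sharp_growth ::
  "'x set \<Rightarrow> ('x \<Rightarrow> real) \<Rightarrow> ('x \<Rightarrow> 'e::euclidean_space) \<Rightarrow> real \<Rightarrow> bool" where
  "sharp_growth X f \<iota> \<kappa> \<longleftrightarrow>
     \<kappa> \<ge> 1 \<and> inj_on \<iota> X \<and> near_opt X f 0 \<noteq> {} \<and>
     (\<exists>\<alpha>>0. \<forall>x\<in>X. ereal (f x) - opt_val X f \<ge> ereal (\<alpha> * eucl_dist \<iota> x (near_opt X f 0) powr \<kappa>))"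

definition LL :: "real \<Rightarrow> real" where
  "LL u = max 1 (ln (ln (max u (exp (exp 1)))))"

definition lil_rate :: "nat \<Rightarrow> real" where
  "lil_rate n = sqrt (LL (real n) / real n)"

end

theory Submission
  imports Defs
begin

text \<open>
  Everything is deterministic once \<open>\<omega>\<close> is fixed: with \<open>\<Delta> = sup |g - f|\<close> one has
  \<open>|inf g - inf f| \<le> \<Delta>\<close>, and a \<open>\<delta>\<close>-minimizer \<open>x\<close> of \<open>g\<close> satisfies \<open>f x - inf f \<le> 2 \<Delta> + \<delta>\<close>.
  The membership events turn this into a bound for all large \<open>n\<close> on almost every path. In mean, the
  complement of the \<open>n\<close>-th event contributes at most its probability times the oscillation of \<open>f\<close>.
  The outer notions transfer such pointwise bounds because any measurable majorant may replace the
  minimal one in an upper estimate.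
\<close>

section \<open>Minimal measurable majorants and the almost-sure outer order\<close>

lemma ennreal_inverse_le_iff: "inverse x \<le> inverse y \<longleftrightarrow> y \<le> x" for x y :: ennreal
proof -
  have "inverse b \<le> inverse a" if "a \<le> b" for a b :: ennreal
    using that by (simp add: less_eq_ennreal.rep_eq inverse_ennreal.rep_eq ereal_inverse_antimono)
  \<comment> \<open>Involutivity, valid also at 0 and infinity, upgrades antitonicity to an
    equivalence.\<close>
  moreover have "inverse (inverse z) = z" for z :: ennreal
    by (cases z; cases "z = 0") (auto simp: inverse_ennreal)
  ultimately show ?thesis by metis
qed

text \<open>\<open>O_as_star\<close> asserts that minimal majorants exist, so an estimate by some
  measurable majorant proves it only once existence is known. Nonnegativity of \<open>U\<close> lets
  the construction take place in \<open>ennreal\<close>.\<close>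

lemma ex_min_meas_majorant:
  fixes U :: "'w \<Rightarrow> ereal"
  assumes fin: "finite_measure M" and nonneg: "\<And>\<omega>. \<omega> \<in> space M \<Longrightarrow> 0 \<le> U \<omega>"
  shows "\<exists>V. min_meas_majorant M U V"
proof -
  interpret finite_measure M by (fact fin)
  \<comment> \<open>\<open>x \<mapsto> inverse (1 + x)\<close> is bounded and strictly antitone on \<open>[0, \<infinity>]\<close>, so maximizing its integral over the
    measurable majorants is possible and picks out the smallest one up to null sets.\<close>
  define \<V> where "\<V> = {V \<in> borel_measurable M. \<forall>\<omega>\<in>space M. e2ennreal (U \<omega>) \<le> V \<omega>}"
  define \<Phi> where "\<Phi> V = (\<integral>\<^sup>+ \<omega>. inverse (1 + V \<omega>) \<partial>M)" for V :: "'w \<Rightarrow> ennreal"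
  have "(\<lambda>_. top) \<in> \<V>" by (auto simp: \<V>_def)
  then have "\<V> \<noteq> {}" by blast
  then obtain v :: "nat \<Rightarrow> ennreal" where v: "range v \<subseteq> \<Phi> ` \<V>" "Sup (\<Phi> ` \<V>) = (SUP i. v i)"
    using ennreal_SUP_countable_SUP[of \<V> \<Phi>] by blast
  have "\<exists>V. V \<in> \<V> \<and> v k = \<Phi> V" for k using v(1) by (simp add: image_subset_iff image_iff) metis
  then obtain F where F: "\<And>k. F k \<in> \<V>" "\<And>k. v k = \<Phi> (F k)" using choice_iff by metis
  \<comment> \<open>A countable infimum of measurable majorants is again one. It lies below every
    \<open>F k\<close>, so its \<open>\<Phi>\<close> dominates the maximizing sequence and attains
    the supremum.\<close>
  define V where "V \<omega> = (INF k. F k \<omega>)" for \<omega>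
  have [measurable]: "F k \<in> borel_measurable M" for k using F(1) by (auto simp: \<V>_def)
  have V[measurable]: "V \<in> borel_measurable M" unfolding V_def by measurable
  have U_le_V: "e2ennreal (U \<omega>) \<le> V \<omega>" if "\<omega> \<in> space M" for \<omega>
    using F(1) that by (auto simp: V_def \<V>_def intro: INF_greatest)
  have "v k \<le> \<Phi> V" for k
    unfolding F(2) \<Phi>_def V_def
    by (intro nn_integral_mono) (auto simp: ennreal_inverse_le_iff intro!: add_left_mono INF_lower)
  then have Sup_le: "Sup (\<Phi> ` \<V>) \<le> \<Phi> V" unfolding v(2) by (rule SUP_least)
  have inverse_le: "inverse (1 + x) \<le> 1" for x :: ennreal
    using ennreal_inverse_le_iff[of "1 + x" 1] by simp
  have "\<Phi> V \<le> (\<integral>\<^sup>+ \<omega>. 1 \<partial>M)" unfolding \<Phi>_def by (intro nn_integral_mono inverse_le)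
  also have "\<dots> < \<infinity>" using emeasure_finite by (simp add: less_top[symmetric])
  finally have \<Phi>_finite: "\<Phi> V \<noteq> \<infinity>" by simp
  have "min_meas_majorant M U (\<lambda>\<omega>. enn2ereal (V \<omega>))"
    unfolding min_meas_majorant_def
  proof (intro conjI ballI impI)
    show "(\<lambda>\<omega>. enn2ereal (V \<omega>)) \<in> borel_measurable M" by measurable
    show "U \<omega> \<le> enn2ereal (V \<omega>)" if "\<omega> \<in> space M" for \<omega>
      using U_le_V[OF that] nonneg[OF that] by (simp add: less_eq_ennreal.rep_eq enn2ereal_e2ennreal)
    fix W :: "'w \<Rightarrow> ereal"
    assume [measurable]: "W \<in> borel_measurable M" and "AE \<omega> in M. U \<omega> \<le> W \<omega>"
    then obtain N where N: "{\<omega>\<in>space M. \<not> U \<omega> \<le> W \<omega>} \<subseteq> N" "emeasure M N = 0" "N \<in> sets M"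
      by (auto elim!: AE_E)
    \<comment> \<open>The competitor \<open>W\<close> majorizes \<open>U\<close> only off the null
      set \<open>N\<close>; keeping \<open>V\<close> on \<open>N\<close> yields a majorant
      everywhere. The minimum gives W' \<le> V, so the two integrands are comparable
      pointwise.\<close>
    define W' where "W' \<omega> = (if \<omega> \<in> N then V \<omega> else min (V \<omega>) (e2ennreal (W \<omega>)))" for \<omega>
    have [measurable]: "N \<in> sets M" by (fact N(3))
    have [measurable]: "W' \<in> borel_measurable M" unfolding W'_def by measurable
    have "W' \<in> \<V>"
      using N(1) U_le_V by (auto simp: \<V>_def W'_def intro!: e2ennreal_mono)
    then have "\<Phi> W' \<le> \<Phi> V" using Sup_le by (rule order_trans[OF SUP_upper])
    have le: "AE \<omega> in M. inverse (1 + V \<omega>) \<le> inverse (1 + W' \<omega>)"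
      by (intro AE_I2) (auto simp: ennreal_inverse_le_iff W'_def intro!: add_left_mono)
    \<comment> \<open>Failure on a non-null set would make \<open>\<Phi> W'\<close> strictly larger
      than \<open>\<Phi> V\<close>, against maximality. Strictness of the integral inequality relies
      on \<open>\<Phi>_finite\<close>.\<close>
    have "AE \<omega> in M. inverse (1 + W' \<omega>) \<le> inverse (1 + V \<omega>)" (is ?ge)
    proof (rule ccontr)
      assume "\<not> ?ge"
      have "\<Phi> V < \<Phi> W'"
        unfolding \<Phi>_def by (rule nn_integral_less[OF _ _ \<Phi>_finite[unfolded \<Phi>_def] le \<open>\<not> ?ge\<close>]) measurable
      with \<open>\<Phi> W' \<le> \<Phi> V\<close> show False by simp
    qed
    moreover have "AE \<omega> in M. \<omega> \<notin> N" using N by (intro AE_not_in) auto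
    ultimately show "AE \<omega> in M. enn2ereal (V \<omega>) \<le> W \<omega>"
      using AE_space \<open>AE \<omega> in M. U \<omega> \<le> W \<omega>\<close>
    proof eventually_elim
      case (elim \<omega>)
      have "V \<omega> \<le> W' \<omega>"
        using elim(1) by (simp add: ennreal_inverse_le_iff)
      then have "V \<omega> \<le> e2ennreal (W \<omega>)" using elim(2) by (simp add: W'_def)
      \<comment> \<open>Since 0 \<le> U \<le> W at this point, the truncation in
        \<open>e2ennreal\<close> leaves \<open>W\<close> unchanged.\<close>
      moreover have "0 \<le> W \<omega>" using nonneg[of \<omega>] elim by auto
      ultimately show ?case by (simp add: less_eq_ennreal.rep_eq enn2ereal_e2ennreal)
    qed
  qed
  then show ?thesis by blast
qed

text \<open>By minimality V n \<le> W n almost everywhere for each \<open>n\<close>, and the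
  countably many null sets combine into one. The constant may depend on \<omega>.\<close>

lemma O_as_starI:
  fixes U W :: "nat \<Rightarrow> 'w \<Rightarrow> ereal"
  assumes fin: "finite_measure M" and r: "\<forall>\<^sub>F n in sequentially. 0 < r n"
    and W[measurable]: "\<And>n. W n \<in> borel_measurable M"
    and le: "\<And>n \<omega>. \<omega> \<in> space M \<Longrightarrow> \<bar>U n \<omega>\<bar> \<le> W n \<omega>"
    and bound: "AE \<omega> in M. \<exists>C::real. \<forall>\<^sub>F n in sequentially. W n \<omega> \<le> ereal (C * r n)"
  shows "O_as_star M U r"
proof -
  have "\<forall>n. \<exists>V. min_meas_majorant M (\<lambda>\<omega>. \<bar>U n \<omega>\<bar>) V"
    using ex_min_meas_majorant[OF fin] by simp
  then obtain V where V: "\<And>n. min_meas_majorant M (\<lambda>\<omega>. \<bar>U n \<omega>\<bar>) (V n)" by metis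
  have "AE \<omega> in M. V n \<omega> \<le> W n \<omega>" for n
    using V[of n] W[of n] le[of _ n] unfolding min_meas_majorant_def by blast
  then have "AE \<omega> in M. \<forall>n. V n \<omega> \<le> W n \<omega>" by (simp add: AE_all_countable)
  with bound have "AE \<omega> in M. limsup (\<lambda>n. V n \<omega> / ereal (r n)) < \<infinity>"
  proof eventually_elim
    case (elim \<omega>)
    then obtain C where "\<forall>\<^sub>F n in sequentially. W n \<omega> \<le> ereal (C * r n)" by blast
    with r have "\<forall>\<^sub>F n in sequentially. V n \<omega> / ereal (r n) \<le> ereal C"
    proof eventually_elim
      case (elim n)
      then have "V n \<omega> \<le> ereal (r n) * ereal C"
        using \<open>\<forall>n. V n \<omega> \<le> W n \<omega>\<close> by (metis mult.commute order_trans times_ereal.simps(1))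
      then show ?case using elim by (simp add: ereal_divide_le_pos)
    qed
    then have "limsup (\<lambda>n. V n \<omega> / ereal (r n)) \<le> ereal C" by (rule Limsup_bounded)
    then show ?case by (rule le_less_trans) simp
  qed
  with V show ?thesis unfolding O_as_star_def by blast
qed

text \<open>Converse of \<open>O_as_starI\<close>: a finite limsup becomes an eventual bound with a
  path-dependent constant, a form in which bounds can be added and raised to powers.\<close>

lemma O_as_starE:
  fixes U :: "nat \<Rightarrow> 'w \<Rightarrow> ereal"
  assumes "O_as_star M U r" and r: "\<forall>\<^sub>F n in sequentially. 0 < r n"
  obtains W where "\<And>n. W n \<in> borel_measurable M"
    and "\<And>n \<omega>. \<omega> \<in> space M \<Longrightarrow> \<bar>U n \<omega>\<bar> \<le> W n \<omega>"
    and "AE \<omega> in M. \<exists>C::real. \<forall>\<^sub>F n in sequentially. W n \<omega> \<le> ereal (C * r n)"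
proof -
  obtain V where V: "\<And>n. min_meas_majorant M (\<lambda>\<omega>. \<bar>U n \<omega>\<bar>) (V n)"
    and lim: "AE \<omega> in M. limsup (\<lambda>n. V n \<omega> / ereal (r n)) < \<infinity>"
    using assms(1) unfolding O_as_star_def by blast
  from lim have "AE \<omega> in M. \<exists>C::real. \<forall>\<^sub>F n in sequentially. V n \<omega> \<le> ereal (C * r n)"
  proof eventually_elim
    case (elim \<omega>)
    then obtain C where "limsup (\<lambda>n. V n \<omega> / ereal (r n)) < ereal C"
      using less_PInf_Ex_of_nat by (metis less_irrefl)
    then have "\<forall>\<^sub>F n in sequentially. V n \<omega> / ereal (r n) < ereal C" by (rule Limsup_lessD)
    with r have "\<forall>\<^sub>F n in sequentially. V n \<omega> \<le> ereal (C * r n)"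
    proof eventually_elim
      case (elim n)
      then show ?case
        using ereal_divide_le_pos[of "ereal (r n)" "V n \<omega>" "ereal C"]
        by (auto simp: mult.commute less_imp_le)
    qed
    then show ?case by blast
  qed
  with that[of V] V show ?thesis unfolding min_meas_majorant_def by blast
qed

text \<open>Solving the growth inequality for \<open>D\<close> bounds it by (W / \<alpha>) to the
  power 1 / \<kappa>. This is a measurable function of a majorant \<open>W\<close> of
  \<open>U\<close>, and it turns the rate \<open>r\<close> into its power.\<close>

lemma O_as_star_powr:
  fixes U :: "nat \<Rightarrow> 'w \<Rightarrow> ereal" and D :: "nat \<Rightarrow> 'w \<Rightarrow> real"
  assumes fin: "finite_measure M" and r: "\<forall>\<^sub>F n in sequentially. 0 < r n"
    and U: "O_as_star M U r" and "0 < \<alpha>" "0 < \<kappa>"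
    and D: "\<And>n \<omega>. \<omega> \<in> space M \<Longrightarrow> 0 \<le> D n \<omega>"
    and le: "\<And>n \<omega>. \<omega> \<in> space M \<Longrightarrow> ereal (\<alpha> * D n \<omega> powr \<kappa>) \<le> U n \<omega>"
  shows "O_as_star M (\<lambda>n \<omega>. ereal (D n \<omega>)) (\<lambda>n. r n powr (1 / \<kappa>))"
proof -
  obtain W where [measurable]: "\<And>n. W n \<in> borel_measurable M"
    and UW: "\<And>n \<omega>. \<omega> \<in> space M \<Longrightarrow> \<bar>U n \<omega>\<bar> \<le> W n \<omega>"
    and bound: "AE \<omega> in M. \<exists>C::real. \<forall>\<^sub>F n in sequentially. W n \<omega> \<le> ereal (C * r n)"
    using O_as_starE[OF U r] by blast
  \<comment> \<open>Infinity is treated separately because \<open>real_of_ereal\<close> sends it to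
    0, which would destroy the majorant property.\<close>
  define Z where "Z n \<omega> =
    (if W n \<omega> = \<infinity> then \<infinity> else ereal ((real_of_ereal (W n \<omega>) / \<alpha>) powr (1 / \<kappa>)))" for n \<omega>
  have W0: "0 \<le> W n \<omega>" if "\<omega> \<in> space M" for n \<omega>
    using UW[OF that, of n] by (rule order_trans[rotated]) simp
  show ?thesis
  proof (rule O_as_starI[OF fin, of _ Z])
    show "\<forall>\<^sub>F n in sequentially. 0 < r n powr (1 / \<kappa>)" using r by eventually_elim simp
    show "Z n \<in> borel_measurable M" for n unfolding Z_def by measurable
    show "\<bar>ereal (D n \<omega>)\<bar> \<le> Z n \<omega>" if "\<omega> \<in> space M" for n \<omega>
    proof (cases "W n \<omega>")
      case (real w)
      have "ereal (\<alpha> * D n \<omega> powr \<kappa>) \<le> ereal w"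
        using le[OF that, of n] UW[OF that, of n] real by (cases "U n \<omega>") auto
      then have "D n \<omega> powr \<kappa> \<le> w / \<alpha>" using \<open>0 < \<alpha>\<close> by (simp add: field_simps)
      then have "(D n \<omega> powr \<kappa>) powr (1 / \<kappa>) \<le> (w / \<alpha>) powr (1 / \<kappa>)"
        using \<open>0 < \<kappa>\<close> by (intro powr_mono2) auto
      then show ?thesis using real D[OF that, of n] \<open>0 < \<kappa>\<close> by (simp add: Z_def powr_powr)
    qed (use W0[OF that, of n] in \<open>auto simp: Z_def\<close>)
    show "AE \<omega> in M. \<exists>C::real. \<forall>\<^sub>F n in sequentially. Z n \<omega> \<le> ereal (C * r n powr (1 / \<kappa>))"
      using bound AE_space
    proof eventually_elim
      case (elim \<omega>)
      then obtain C where "\<forall>\<^sub>F n in sequentially. W n \<omega> \<le> ereal (C * r n)" by blast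
      with r have "\<forall>\<^sub>F n in sequentially. Z n \<omega> \<le> ereal ((C / \<alpha>) powr (1 / \<kappa>) * r n powr (1 / \<kappa>))"
      proof eventually_elim
        case (elim n)
        then obtain w where w: "W n \<omega> = ereal w" "0 \<le> w" "w \<le> C * r n"
          using W0[OF \<open>\<omega> \<in> space M\<close>, of n] by (cases "W n \<omega>") auto
        \<comment> \<open>From 0 \<le> w \<le> C * r n with r n > 0; the sign of \<open>C\<close> is
          used to split the power of the product.\<close>
        then have "0 \<le> C" using elim(1) by (meson order_trans zero_le_mult_iff not_less)
        have "(w / \<alpha>) powr (1 / \<kappa>) \<le> ((C / \<alpha>) * r n) powr (1 / \<kappa>)"
          using w \<open>0 < \<alpha>\<close> \<open>0 < \<kappa>\<close> by (intro powr_mono2) (auto simp: field_simps)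
        also have "\<dots> = (C / \<alpha>) powr (1 / \<kappa>) * r n powr (1 / \<kappa>)"
          using \<open>0 \<le> C\<close> \<open>0 < \<alpha>\<close> elim(1) by (intro powr_mult)
        finally show ?case using w by (simp add: Z_def)
      qed
      then show ?case by blast
    qed
  qed
qed

section \<open>Outer expectations of nonnegative functions\<close>

lemma outer_expectation_le_nn_integral:
  assumes [measurable]: "g \<in> borel_measurable M"
    and "\<And>\<omega>. \<omega> \<in> space M \<Longrightarrow> U \<omega> \<le> enn2ereal (g \<omega>)"
  shows "outer_expectation M U \<le> enn2ereal (\<integral>\<^sup>+ \<omega>. g \<omega> \<partial>M)"
proof -
  \<comment> \<open>The negative part of an \<open>ennreal\<close>-valued majorant vanishes, so its
    expectation exists and equals its nonnegative integral.\<close>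
  have neg: "e2ennreal (- enn2ereal x) = 0" for x
    by (simp add: e2ennreal_neg)
  have "ext_expectation M (\<lambda>\<omega>. enn2ereal (g \<omega>)) = enn2ereal (\<integral>\<^sup>+ \<omega>. g \<omega> \<partial>M)"
    "ext_expectation_exists M (\<lambda>\<omega>. enn2ereal (g \<omega>))"
    by (simp_all add: ext_expectation_def ext_expectation_exists_def neg zero_ennreal.rep_eq)
  moreover have "(\<lambda>\<omega>. enn2ereal (g \<omega>)) \<in> borel_measurable M" by measurable
  ultimately show ?thesis
    unfolding outer_expectation_def using assms(2)
    by (intro Inf_lower CollectI exI[of _ "\<lambda>\<omega>. enn2ereal (g \<omega>)"]) auto
qed

lemma ext_expectation_nonneg_eq:
  assumes "\<And>\<omega>. \<omega> \<in> space M \<Longrightarrow> 0 \<le> V \<omega>"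
  shows "ext_expectation M V = enn2ereal (\<integral>\<^sup>+ \<omega>. e2ennreal (V \<omega>) \<partial>M)"
proof -
  have "(\<integral>\<^sup>+ \<omega>. e2ennreal (- V \<omega>) \<partial>M) = (\<integral>\<^sup>+ \<omega>. 0 \<partial>M)"
    using assms by (intro nn_integral_cong) (simp add: e2ennreal_neg)
  then show ?thesis by (simp add: ext_expectation_def zero_ennreal.rep_eq)
qed

lemma outer_expectation_nonneg:
  assumes "\<And>\<omega>. \<omega> \<in> space M \<Longrightarrow> 0 \<le> U \<omega>"
  shows "0 \<le> outer_expectation M U"
  unfolding outer_expectation_def
proof (rule Inf_greatest, clarify)
  fix V assume "\<forall>\<omega>\<in>space M. U \<omega> \<le> V \<omega>"
  then show "0 \<le> ext_expectation M V"
    using assms by (subst ext_expectation_nonneg_eq) (auto intro: order_trans)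
qed

text \<open>An infimum supplies majorants with expectation below any strictly larger number. A
  majorant of a nonnegative function is nonnegative, hence may be taken
  \<open>ennreal\<close>-valued.\<close>

lemma outer_expectation_lessE:
  assumes "outer_expectation M U < c" and nonneg: "\<And>\<omega>. \<omega> \<in> space M \<Longrightarrow> 0 \<le> U \<omega>"
  obtains g where "g \<in> borel_measurable M" "\<And>\<omega>. \<omega> \<in> space M \<Longrightarrow> U \<omega> \<le> enn2ereal (g \<omega>)"
    "enn2ereal (\<integral>\<^sup>+ \<omega>. g \<omega> \<partial>M) < c"
proof -
  obtain V where V[measurable]: "V \<in> borel_measurable M" and UV: "\<forall>\<omega>\<in>space M. U \<omega> \<le> V \<omega>"
    and less: "ext_expectation M V < c"
    using assms(1) unfolding outer_expectation_def Inf_less_iff by auto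
  have V0: "0 \<le> V \<omega>" if "\<omega> \<in> space M" for \<omega> using UV nonneg[OF that] that by force
  show ?thesis
  proof (rule that[of "\<lambda>\<omega>. e2ennreal (V \<omega>)"])
    show "U \<omega> \<le> enn2ereal (e2ennreal (V \<omega>))" if "\<omega> \<in> space M" for \<omega>
      using UV V0 that by (simp add: enn2ereal_e2ennreal)
    show "enn2ereal (\<integral>\<^sup>+ \<omega>. e2ennreal (V \<omega>) \<partial>M) < c"
      using less by (simp add: ext_expectation_nonneg_eq V0)
  qed measurable
qed

text \<open>Only \<open>U\<close> and \<open>U'\<close> may be nonmeasurable. Replacing
  \<open>U\<close> by a nearly optimal measurable \<open>g\<close> leaves an affine measurable
  majorant of \<open>U'\<close>, to which linearity of the integral applies. The indicator term pays
  for the event where the main estimate fails.\<close>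

lemma outer_expectation_affine_bound:
  fixes U U' :: "'w \<Rightarrow> ereal" and a b B c :: real
  assumes "prob_space M" and A[measurable]: "A \<in> sets M"
    and coeff: "0 \<le> a" "0 \<le> b" "0 \<le> B"
    and U: "\<And>\<omega>. \<omega> \<in> space M \<Longrightarrow> 0 \<le> U \<omega>"
    and U': "\<And>\<omega>. \<omega> \<in> space M \<Longrightarrow> U' \<omega> \<le> ereal a * U \<omega> + ereal b + ereal (B * indicator (space M - A) \<omega>)"
    and c: "outer_expectation M U \<le> ereal c"
  shows "outer_expectation M U' \<le> ereal (a * c + b + B * measure M (space M - A))"
proof (rule ereal_le_epsilon2)
  interpret prob_space M by fact
  fix e :: real assume "0 < e"
  \<comment> \<open>Chosen so that a * d \<le> e; the summand 1 keeps the denominator positive when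
    \<open>a\<close> is 0.\<close>
  define d where "d = e / (a + 1)"
  have "0 < d" using \<open>0 < e\<close> coeff by (simp add: d_def)
  then have "outer_expectation M U < ereal (c + d)" using c by (simp add: le_less_trans)
  then obtain g where g[measurable]: "g \<in> borel_measurable M"
    and Ug: "\<And>\<omega>. \<omega> \<in> space M \<Longrightarrow> U \<omega> \<le> enn2ereal (g \<omega>)"
    and less: "enn2ereal (\<integral>\<^sup>+ \<omega>. g \<omega> \<partial>M) < ereal (c + d)"
    using outer_expectation_lessE[of M U "ereal (c + d)"] U by blast
  let ?k = "\<lambda>\<omega>. ennreal a * g \<omega> + ennreal b + ennreal B * indicator (space M - A) \<omega>"
  have eq: "enn2ereal (ennreal a * x + ennreal b + ennreal B * indicator S \<omega>)
      = ereal a * enn2ereal x + ereal b + ereal (B * indicator S \<omega>)" for x S and \<omega> :: 'w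
    using coeff by (auto simp: plus_ennreal.rep_eq times_ennreal.rep_eq zero_ennreal.rep_eq one_ennreal.rep_eq
        split: split_indicator)
  have "outer_expectation M U' \<le> enn2ereal (\<integral>\<^sup>+ \<omega>. ?k \<omega> \<partial>M)"
  proof (rule outer_expectation_le_nn_integral)
    fix \<omega> assume \<omega>: "\<omega> \<in> space M"
    have "ereal a * U \<omega> \<le> ereal a * enn2ereal (g \<omega>)"
      using Ug[OF \<omega>] coeff by (intro ereal_mult_left_mono) auto
    with U'[OF \<omega>] show "U' \<omega> \<le> enn2ereal (?k \<omega>)"
      unfolding eq by (meson add_right_mono order_trans)
  qed measurable
  also have "(\<integral>\<^sup>+ \<omega>. ?k \<omega> \<partial>M)
      = ennreal a * (\<integral>\<^sup>+ \<omega>. g \<omega> \<partial>M) + ennreal b + ennreal B * emeasure M (space M - A)"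
    by (simp add: nn_integral_add nn_integral_cmult nn_integral_cmult_indicator emeasure_space_1)
  also have "enn2ereal \<dots>
      = ereal a * enn2ereal (\<integral>\<^sup>+ \<omega>. g \<omega> \<partial>M) + ereal b + ereal (B * measure M (space M - A))"
    using coeff by (simp add: emeasure_eq_measure plus_ennreal.rep_eq times_ennreal.rep_eq)
  also have "\<dots> \<le> ereal a * ereal (c + d) + ereal b + ereal (B * measure M (space M - A))"
    using less coeff by (intro add_right_mono ereal_mult_left_mono) auto
  also have "\<dots> \<le> ereal (a * c + b + B * measure M (space M - A)) + ereal e"
  proof -
    have "a * d \<le> (a + 1) * d" using \<open>0 < d\<close> by simp
    also have "\<dots> = e" using coeff by (simp add: d_def)
    finally show ?thesis by (simp add: algebra_simps)
  qed
  finally show "outer_expectation M U' \<le> ereal (a * c + b + B * measure M (space M - A)) + ereal e" .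
qed

text \<open>Common form of the three mean bounds, for the optimal value, the excess and the
  distance. Nonnegativity of \<open>U\<close> and \<open>U'\<close> removes the absolute values in
  \<open>ereal_bigo\<close>.\<close>

lemma ereal_bigo_outer_expectation:
  fixes U U' :: "nat \<Rightarrow> 'w \<Rightarrow> ereal" and b :: "nat \<Rightarrow> real" and a B :: real
  assumes prob: "prob_space M" and A: "\<And>n. A n \<in> sets M"
    and coeff: "0 \<le> a" "\<And>n. 0 \<le> b n" "0 \<le> B"
    and U: "\<And>n \<omega>. \<omega> \<in> space M \<Longrightarrow> 0 \<le> U n \<omega>"
    and U'0: "\<And>n \<omega>. \<omega> \<in> space M \<Longrightarrow> 0 \<le> U' n \<omega>"
    and U': "\<And>n \<omega>. \<omega> \<in> space M \<Longrightarrow>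
      U' n \<omega> \<le> ereal a * U n \<omega> + ereal (b n) + ereal (B * indicator (space M - A n) \<omega>)"
    and big: "ereal_bigo (\<lambda>n. outer_expectation M (U n)) r" "b \<in> O(r)"
      "(\<lambda>n. measure M (space M - A n)) \<in> O(r)"
  shows "ereal_bigo (\<lambda>n. outer_expectation M (U' n)) r"
proof -
  obtain C1 where C1: "\<forall>\<^sub>F n in sequentially. \<bar>outer_expectation M (U n)\<bar> \<le> ereal (C1 * \<bar>r n\<bar>)"
    using big(1) unfolding ereal_bigo_def by blast
  obtain C2 where C2: "\<forall>\<^sub>F n in sequentially. norm (b n) \<le> C2 * norm (r n)"
    using big(2) by (auto elim: landau_o.bigE)
  obtain C3 where C3: "\<forall>\<^sub>F n in sequentially. norm (measure M (space M - A n)) \<le> C3 * norm (r n)"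
    using big(3) by (auto elim: landau_o.bigE)
  have "\<forall>\<^sub>F n in sequentially.
      \<bar>outer_expectation M (U' n)\<bar> \<le> ereal ((a * C1 + C2 + B * C3) * \<bar>r n\<bar>)"
    using C1 C2 C3
  proof eventually_elim
    case (elim n)
    have "outer_expectation M (U n) \<le> ereal (C1 * \<bar>r n\<bar>)"
      using elim(1) outer_expectation_nonneg[of M "U n"] U by simp
    then have "outer_expectation M (U' n)
        \<le> ereal (a * (C1 * \<bar>r n\<bar>) + b n + B * measure M (space M - A n))"
      using outer_expectation_affine_bound[OF prob A coeff(1) coeff(2) coeff(3) U U'] by blast
    also have "\<dots> \<le> ereal (a * (C1 * \<bar>r n\<bar>) + C2 * \<bar>r n\<bar> + B * (C3 * \<bar>r n\<bar>))"
      using elim(2,3) coeff by (auto intro!: add_mono mult_left_mono)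
    also have "\<dots> = ereal ((a * C1 + C2 + B * C3) * \<bar>r n\<bar>)" by (simp add: algebra_simps)
    finally show ?case using outer_expectation_nonneg[of M "U' n"] U'0 by simp
  qed
  then show ?thesis unfolding ereal_bigo_def by blast
qed

section \<open>Deterministic perturbation bounds for infima and near-minimizers\<close>

lemma opt_val_lower: "x \<in> X \<Longrightarrow> opt_val X g \<le> ereal (g x)"
  unfolding opt_val_def by (rule INF_lower)

lemma opt_val_finite:
  assumes "X \<noteq> {}" "bounded (f ` X)"
  obtains p where "opt_val X f = ereal p"
proof -
  obtain x where "x \<in> X" using assms by blast
  obtain B where "\<And>y. y \<in> X \<Longrightarrow> \<bar>f y\<bar> \<le> B" using assms(2) by (auto simp: bounded_iff)
  then have "ereal (- B) \<le> opt_val X f"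
    unfolding opt_val_def by (intro INF_greatest) (simp add: abs_le_iff minus_le_iff)
  with opt_val_lower[OF \<open>x \<in> X\<close>, of f] that show ?thesis by (cases "opt_val X f") auto
qed

lemma sup_dev_upper: "x \<in> X \<Longrightarrow> ereal \<bar>g x - f x\<bar> \<le> sup_dev X g f"
  unfolding sup_dev_def by (rule SUP_upper)

lemma sup_dev_nonneg: "X \<noteq> {} \<Longrightarrow> 0 \<le> sup_dev X g f"
  by (meson abs_ge_zero all_not_in_conv ereal_less_eq(5) order_trans sup_dev_upper)

text \<open>An infinite deviation makes the claim trivial. For a finite one, both inequalities
  follow from the universal property of the infimum, with no boundedness of \<open>g\<close>
  presupposed.\<close>

lemma opt_val_diff_le_sup_dev:
  assumes "X \<noteq> {}" "bounded (f ` X)"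
  shows "\<bar>opt_val X g - opt_val X f\<bar> \<le> sup_dev X g f"
proof (cases "sup_dev X g f")
  case (real d)
  obtain p where p: "opt_val X f = ereal p" by (rule opt_val_finite[OF assms(1,2)])
  have dev: "\<bar>g x - f x\<bar> \<le> d" if "x \<in> X" for x
    using sup_dev_upper[OF that, of g f] real by simp
  have "ereal (p - d) \<le> opt_val X g"
    unfolding opt_val_def
  proof (rule INF_greatest)
    fix x assume "x \<in> X"
    then show "ereal (p - d) \<le> ereal (g x)"
      using dev[of x] opt_val_lower[of x X f] p by (simp add: abs_le_iff)
  qed
  moreover have "opt_val X g - ereal d \<le> opt_val X f"
    unfolding opt_val_def[of X f]
  proof (rule INF_greatest)
    fix x assume "x \<in> X"
    then show "opt_val X g - ereal d \<le> ereal (f x)"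
      using dev[of x] opt_val_lower[of x X g] by (cases "opt_val X g") (auto simp: abs_le_iff)
  qed
  \<comment> \<open>The two inequalities also exclude infinite values of \<open>opt_val X g\<close>,
    as \<open>p\<close> and \<open>d\<close> are real.\<close>
  ultimately show ?thesis using p real by (cases "opt_val X g") (auto simp: abs_le_iff)
next
  case MInf
  then show ?thesis using sup_dev_nonneg[OF assms(1), of g f] by simp
qed simp

text \<open>One deviation is spent on passing from \<open>f\<close> to \<open>g\<close> at
  \<open>x\<close>, the other on passing from the infimum of \<open>g\<close> to that of
  \<open>f\<close>; this explains the factor 2.\<close>

lemma near_opt_excess_le:
  assumes "X \<noteq> {}" "bounded (f ` X)" and x: "x \<in> near_opt X g \<delta>"
  shows "ereal (f x) - opt_val X f \<le> 2 * sup_dev X g f + ereal \<delta>"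
proof (cases "sup_dev X g f")
  case (real d)
  obtain p where p: "opt_val X f = ereal p" by (rule opt_val_finite[OF assms(1,2)])
  have "x \<in> X" and gx: "ereal (g x) \<le> opt_val X g + ereal \<delta>" using x by (auto simp: near_opt_def)
  then have "\<bar>g x - f x\<bar> \<le> d" using sup_dev_upper[of x X g f] real by simp
  with gx opt_val_diff_le_sup_dev[OF assms(1,2), of g] p real show ?thesis
    by (cases "opt_val X g") (auto simp: abs_le_iff)
next
  case MInf
  then show ?thesis using sup_dev_nonneg[OF assms(1), of g f] by simp
qed simp

section \<open>The iterated-logarithm rate and the proof of both assertions\<close>

lemma lil_rate_pos: "0 < n \<Longrightarrow> 0 < lil_rate n"
  by (simp add: lil_rate_def LL_def max_def)

theorem theorem4p6:
  fixes M :: "'w measure" and G :: "'s measure" and \<xi> :: "nat \<Rightarrow> 'w \<Rightarrow> 's"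
    and X :: "'x set" and h :: "'x \<Rightarrow> 's \<Rightarrow> real"
    and f :: "'x \<Rightarrow> real" and fhat :: "nat \<Rightarrow> 'w \<Rightarrow> 'x \<Rightarrow> real"
  assumes prob: "prob_space M"
    and indep: "prob_space.indep_vars M (\<lambda>_. G) \<xi> UNIV"
    and ident: "\<And>i. distr M G (\<xi> i) = distr M G (\<xi> 0)"
    and X_nonempty: "X \<noteq> {}"
    and h_meas: "\<And>x. x \<in> X \<Longrightarrow> h x \<in> borel_measurable G"
    and h_int: "\<And>x. x \<in> X \<Longrightarrow> integrable (distr M G (\<xi> 0)) (h x)"
    and f_def: "f = true_obj M \<xi> h"
    and fhat_def: "fhat = emp_obj \<xi> h"
    and f_bounded: "bounded (f ` X)"
    and dev_bounded: "\<forall>\<^sub>F n in sequentially. AE \<omega> in M. bounded ((\<lambda>x. fhat n \<omega> x - f x) ` X)"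
  shows
    "(O_as_star M (\<lambda>n \<omega>. sup_dev X (fhat n \<omega>) f) lil_rate \<longrightarrow>
        O_as_star M (\<lambda>n \<omega>. \<bar>opt_val X (fhat n \<omega>) - opt_val X f\<bar>) lil_rate \<and>
        (\<forall>\<delta> xhat.
           (\<forall>n. 0 \<le> \<delta> n) \<and> \<delta> \<in> O(lil_rate) \<and>
           (\<forall>n. xhat n \<in> space M \<rightarrow> X) \<and>
           (\<exists>A. emp_min_membership M X fhat \<delta> xhat A) \<longrightarrow>
             O_as_star M (\<lambda>n \<omega>. ereal (f (xhat n \<omega>)) - opt_val X f) lil_rate \<and>
             (\<forall>(\<iota> :: 'x \<Rightarrow> 'e::euclidean_space) \<kappa>. sharp_growth X f \<iota> \<kappa> \<longrightarrow>
                O_as_star M (\<lambda>n \<omega>. ereal (eucl_dist \<iota> (xhat n \<omega>) (near_opt X f 0)))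
                  (\<lambda>n. lil_rate n powr (1 / \<kappa>)))))
     \<and>
     (\<forall>\<rho> :: nat \<Rightarrow> real.
        decseq \<rho> \<and> \<rho> \<longlonglongrightarrow> 0 \<and>
        ereal_bigo (\<lambda>n. outer_expectation M (\<lambda>\<omega>. sup_dev X (fhat n \<omega>) f)) \<rho> \<longrightarrow>
          ereal_bigo
            (\<lambda>n. outer_expectation M (\<lambda>\<omega>. \<bar>opt_val X (fhat n \<omega>) - opt_val X f\<bar>)) \<rho> \<and>
          (\<forall>\<delta> xhat A.
             (\<forall>n. 0 \<le> \<delta> n) \<and> \<delta> \<in> O(\<rho>) \<and>
             (\<forall>n. xhat n \<in> space M \<rightarrow> X) \<and>
             emp_min_membership M X fhat \<delta> xhat A \<and>
             (\<lambda>n. measure M (space M - A n)) \<in> O(\<rho>) \<longrightarrow>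
               ereal_bigo
                 (\<lambda>n. outer_expectation M (\<lambda>\<omega>. ereal (f (xhat n \<omega>)) - opt_val X f)) \<rho> \<and>
               (\<forall>(\<iota> :: 'x \<Rightarrow> 'e) \<kappa>. sharp_growth X f \<iota> \<kappa> \<longrightarrow>
                  ereal_bigo
                    (\<lambda>n. outer_expectation M
                       (\<lambda>\<omega>. ereal (eucl_dist \<iota> (xhat n \<omega>) (near_opt X f 0) powr \<kappa>))) \<rho>)))"
proof -
  interpret prob_space M by (fact prob)
  have fin: "finite_measure M" by unfold_locales
  \<comment> \<open>Positivity holds only eventually: at index 0, division by zero makes the rate
    0.\<close>
  have rate: "\<forall>\<^sub>F n in sequentially. 0 < lil_rate n"
    using eventually_gt_at_top[of 0] by eventually_elim (rule lil_rate_pos)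
  obtain p where p: "opt_val X f = ereal p" by (rule opt_val_finite[OF X_nonempty f_bounded])
  obtain B where "\<And>x. x \<in> X \<Longrightarrow> \<bar>f x\<bar> \<le> B" using f_bounded by (auto simp: bounded_iff)
  \<comment> \<open>The bound is a worst-case excess over \<open>X\<close>, made nonnegative by the
    maximum. It will weight the complements of the events \<open>A n\<close> in the mean
    estimate.\<close>
  then have "\<And>x. x \<in> X \<Longrightarrow> f x - p \<le> max 0 (B - p)" by fastforce
  then obtain K where "0 \<le> K" and excess_bounded: "\<And>x. x \<in> X \<Longrightarrow> f x - p \<le> K"
    using max.cobounded1 by blast
  have excess_nonneg: "0 \<le> ereal (f x) - opt_val X f" if "x \<in> X" for x
    using opt_val_lower[OF that, of f] p by simp
  note dev0 = sup_dev_nonneg[OF X_nonempty, of _ f]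
  note val_le = opt_val_diff_le_sup_dev[OF X_nonempty f_bounded]
  note excess_le = near_opt_excess_le[OF X_nonempty f_bounded]
  show ?thesis
  proof (intro conjI impI allI; (elim conjE)?)
    assume dev: "O_as_star M (\<lambda>n \<omega>. sup_dev X (fhat n \<omega>) f) lil_rate"
    obtain W where W[measurable]: "\<And>n. W n \<in> borel_measurable M"
      and devW: "\<And>n \<omega>. \<omega> \<in> space M \<Longrightarrow> \<bar>sup_dev X (fhat n \<omega>) f\<bar> \<le> W n \<omega>"
      and bound: "AE \<omega> in M. \<exists>C::real. \<forall>\<^sub>F n in sequentially. W n \<omega> \<le> ereal (C * lil_rate n)"
      using O_as_starE[OF dev rate] by blast
    show "O_as_star M (\<lambda>n \<omega>. \<bar>opt_val X (fhat n \<omega>) - opt_val X f\<bar>) lil_rate"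
      using val_le devW dev0 by (intro O_as_starI[OF fin rate W _ bound]) (auto intro: order_trans)
    fix \<delta> xhat
    assume \<delta>0: "\<forall>n. 0 \<le> \<delta> n" and \<delta>: "\<delta> \<in> O(lil_rate)" and xhat: "\<forall>n. xhat n \<in> space M \<rightarrow> X"
      and "\<exists>A. emp_min_membership M X fhat \<delta> xhat A"
    then obtain A where [measurable]: "\<And>n. A n \<in> sets M" and inc: "\<And>n. A n \<subseteq> A (Suc n)"
      and A1: "measure M (\<Union>n. A n) = 1"
      \<comment> \<open>The diagonal instance n = N of the membership condition.\<close>
      and mem: "\<And>n \<omega>. \<omega> \<in> A n \<Longrightarrow> xhat n \<omega> \<in> near_opt X (fhat n \<omega>) (\<delta> n)"
      unfolding emp_min_membership_def by blast
    obtain c where c: "\<forall>\<^sub>F n in sequentially. norm (\<delta> n) \<le> c * norm (lil_rate n)"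
      using \<delta> by (auto elim: landau_o.bigE)
    have "AE \<omega> in M. \<omega> \<in> (\<Union>n. A n)" using A1 by (subst (asm) prob_eq_1) auto
    show excess: "O_as_star M (\<lambda>n \<omega>. ereal (f (xhat n \<omega>)) - opt_val X f) lil_rate"
    \<comment> \<open>On \<open>A n\<close> the deterministic excess bound applies; off
      \<open>A n\<close> the value infinity makes the majorant valid trivially. Almost every path
      meets that value for only finitely many \<open>n\<close>.\<close>
    proof (rule O_as_starI[OF fin rate, of "\<lambda>n \<omega>. if \<omega> \<in> A n then 2 * W n \<omega> + ereal (\<delta> n) else \<infinity>"])
      show "(\<lambda>\<omega>. if \<omega> \<in> A n then 2 * W n \<omega> + ereal (\<delta> n) else \<infinity>) \<in> borel_measurable M" for n
        by measurable
      fix n \<omega> assume \<omega>: "\<omega> \<in> space M"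
      have "ereal (f (xhat n \<omega>)) - opt_val X f \<le> 2 * W n \<omega> + ereal (\<delta> n)" if "\<omega> \<in> A n"
      proof -
        have "2 * sup_dev X (fhat n \<omega>) f \<le> 2 * W n \<omega>"
          using devW[OF \<omega>, of n] dev0[of "fhat n \<omega>"] by (intro ereal_mult_left_mono) auto
        then show ?thesis using excess_le[OF mem[OF that]] by (meson add_right_mono order_trans)
      qed
      then show "\<bar>ereal (f (xhat n \<omega>)) - opt_val X f\<bar>
          \<le> (if \<omega> \<in> A n then 2 * W n \<omega> + ereal (\<delta> n) else \<infinity>)"
        using excess_nonneg[of "xhat n \<omega>"] xhat \<omega> by (auto simp: Pi_iff)
    next
      show "AE \<omega> in M. \<exists>C::real. \<forall>\<^sub>F n in sequentially.
          (if \<omega> \<in> A n then 2 * W n \<omega> + ereal (\<delta> n) else \<infinity>) \<le> ereal (C * lil_rate n)"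
        using bound \<open>AE \<omega> in M. \<omega> \<in> (\<Union>n. A n)\<close>
      proof eventually_elim
        case (elim \<omega>)
        then obtain C N where C: "\<forall>\<^sub>F n in sequentially. W n \<omega> \<le> ereal (C * lil_rate n)"
          and N: "\<omega> \<in> A N" by blast
        \<comment> \<open>The events increase, so a path in \<open>A N\<close> stays in all later
          ones.\<close>
        have "\<forall>\<^sub>F n in sequentially. \<omega> \<in> A n"
          using eventually_ge_at_top[of N] by eventually_elim (use N inc lift_Suc_mono_le[of A] in blast)
        \<comment> \<open>Twice the path constant \<open>C\<close> of the deviation plus the
          deterministic constant \<open>c\<close> of \<open>\<delta>\<close>.\<close>
        then have "\<forall>\<^sub>F n in sequentially. (if \<omega> \<in> A n then 2 * W n \<omega> + ereal (\<delta> n) else \<infinity>)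
            \<le> ereal ((2 * C + c) * lil_rate n)"
          using C c rate
        proof eventually_elim
          case (elim n)
          then show ?case by (cases "W n \<omega>") (auto simp: algebra_simps abs_le_iff)
        qed
        then show ?case by blast
      qed
    qed
    fix \<iota> :: "'x \<Rightarrow> 'e" and \<kappa>
    assume "sharp_growth X f \<iota> \<kappa>"
    then obtain \<alpha> where "1 \<le> \<kappa>" "0 < \<alpha>" and growth:
      "\<And>x. x \<in> X \<Longrightarrow> ereal (\<alpha> * eucl_dist \<iota> x (near_opt X f 0) powr \<kappa>) \<le> ereal (f x) - opt_val X f"
      unfolding sharp_growth_def by blast
    show "O_as_star M (\<lambda>n \<omega>. ereal (eucl_dist \<iota> (xhat n \<omega>) (near_opt X f 0)))
        (\<lambda>n. lil_rate n powr (1 / \<kappa>))"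
      using growth xhat \<open>1 \<le> \<kappa>\<close>
      by (intro O_as_star_powr[OF fin rate excess \<open>0 < \<alpha>\<close>]) (auto simp: eucl_dist_def infdist_nonneg Pi_iff)
  next
    fix \<rho> :: "nat \<Rightarrow> real"
    assume dev: "ereal_bigo (\<lambda>n. outer_expectation M (\<lambda>\<omega>. sup_dev X (fhat n \<omega>) f)) \<rho>"
    \<comment> \<open>The value gap is at most the deviation on every path, so the coefficient is 1
      and the exceptional event is empty.\<close>
    show "ereal_bigo (\<lambda>n. outer_expectation M (\<lambda>\<omega>. \<bar>opt_val X (fhat n \<omega>) - opt_val X f\<bar>)) \<rho>"
      by (rule ereal_bigo_outer_expectation[where a = 1 and b = "\<lambda>_. 0" and B = 0 and A = "\<lambda>_. space M", OF prob])
        (use dev val_le dev0 in \<open>auto simp: one_ereal_def[symmetric] zero_ereal_def[symmetric]\<close>)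
    fix \<delta> xhat A
    assume \<delta>0: "\<forall>n. 0 \<le> \<delta> n" and \<delta>: "\<delta> \<in> O(\<rho>)" and xhat: "\<forall>n. xhat n \<in> space M \<rightarrow> X"
      and "emp_min_membership M X fhat \<delta> xhat A" and PA: "(\<lambda>n. measure M (space M - A n)) \<in> O(\<rho>)"
    then have A: "\<And>n. A n \<in> sets M"
      and mem: "\<And>n \<omega>. \<omega> \<in> A n \<Longrightarrow> xhat n \<omega> \<in> near_opt X (fhat n \<omega>) (\<delta> n)"
      unfolding emp_min_membership_def by blast+
    show excess: "ereal_bigo (\<lambda>n. outer_expectation M (\<lambda>\<omega>. ereal (f (xhat n \<omega>)) - opt_val X f)) \<rho>"
    \<comment> \<open>On \<open>A n\<close> the excess is at most twice the deviation plus
      \<open>\<delta> n\<close>; off \<open>A n\<close> it is at most \<open>K\<close>, whose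
      contribution is controlled by \<open>PA\<close>.\<close>
    proof (rule ereal_bigo_outer_expectation[where a = 2 and b = \<delta> and B = "K" and A = A,
          OF prob A _ _ _ dev0 _ _ dev \<delta> PA])
      fix n \<omega> assume \<omega>: "\<omega> \<in> space M"
      then have x: "xhat n \<omega> \<in> X" using xhat by (auto simp: Pi_iff)
      show "0 \<le> ereal (f (xhat n \<omega>)) - opt_val X f" using excess_nonneg[OF x] .
      show "ereal (f (xhat n \<omega>)) - opt_val X f \<le> ereal 2 * sup_dev X (fhat n \<omega>) f + ereal (\<delta> n)
          + ereal (K * indicator (space M - A n) \<omega>)"
      proof (cases "\<omega> \<in> A n")
        case True
        then show ?thesis using excess_le[OF mem[OF True]] by (simp add: zero_ereal_def[symmetric])
      next
        case False
        have "0 \<le> ereal 2 * sup_dev X (fhat n \<omega>) f + ereal (\<delta> n)" using dev0 \<delta>0 by simp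
        then have "0 + ereal (K) \<le> ereal 2 * sup_dev X (fhat n \<omega>) f + ereal (\<delta> n)
            + ereal (K)" by (rule add_right_mono)
        moreover have "ereal (f (xhat n \<omega>)) - opt_val X f \<le> ereal (K)"
          using excess_bounded[OF x] p by simp
        ultimately show ?thesis using False \<omega> by simp
      qed
    qed (use \<delta>0 \<open>0 \<le> K\<close> in auto)
    fix \<iota> :: "'x \<Rightarrow> 'e" and \<kappa>
    assume "sharp_growth X f \<iota> \<kappa>"
    then obtain \<alpha> where "0 < \<alpha>" and growth:
      "\<And>x. x \<in> X \<Longrightarrow> ereal (\<alpha> * eucl_dist \<iota> x (near_opt X f 0) powr \<kappa>) \<le> ereal (f x) - opt_val X f"
      unfolding sharp_growth_def by blast
    show "ereal_bigo (\<lambda>n. outer_expectation M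
        (\<lambda>\<omega>. ereal (eucl_dist \<iota> (xhat n \<omega>) (near_opt X f 0) powr \<kappa>))) \<rho>"
    \<comment> \<open>Growth divided by \<alpha> bounds the powered distance by the excess on all of
      \<open>X\<close>, so the mean bound for the excess is reused with no exceptional
      event.\<close>
    proof (rule ereal_bigo_outer_expectation[where a = "1 / \<alpha>" and b = "\<lambda>_. 0" and B = 0
          and A = "\<lambda>_. space M", OF prob _ _ _ _ _ _ _ excess])
      fix n \<omega> assume "\<omega> \<in> space M"
      then have x: "xhat n \<omega> \<in> X" using xhat by (auto simp: Pi_iff)
      show "0 \<le> ereal (f (xhat n \<omega>)) - opt_val X f" using excess_nonneg[OF x] .
      show "ereal (eucl_dist \<iota> (xhat n \<omega>) (near_opt X f 0) powr \<kappa>)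
          \<le> ereal (1 / \<alpha>) * (ereal (f (xhat n \<omega>)) - opt_val X f) + ereal 0
            + ereal (0 * indicator (space M - space M) \<omega>)"
        using growth[OF x] \<open>0 < \<alpha>\<close> p by (simp add: field_simps)
    qed (use \<open>0 < \<alpha>\<close> in auto)
  qed
qed

end
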